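(* Let $P$ be a finite poset, and let $P=A\sqcup B$ be a partition of its underlying set, where $A$ and $B$ carry the orders $\leq_A,\leq_B$ induced from $P$. The following are equivalent: (i) There exists a Ladkani family $\mathcal{B}=(B_a)_{a\in A}$ of subsets of $B$ such that $P=(A\sqcup B)^+_{\mathcal{B}}$ (equality of partial orders on the same underlying set). (ii) $P=A\sqcup B$ is an admissible cut. Moreover, whenever these equivalent conditions hold, the subsets $B_a$ in (i) are necessarily given by $B_a=M(a)$ for every $a\in A$.
   Context: Ladkani family and positive poset: Let $A,B$ be finite posets. For $b\in B$ put $[b,\bullet]_B=\{b'\in B: b\leq_B b'\}$ and $[\bullet,b]_B=\{b'\in B: b'\leq_B b\}$. A family $\mathcal{B}=(B_a)_{a\in A}$ of subsets of $B$ is called a Ladkani family if: (1) for every $a\in A$ and all distinct $y,y'\in B_a$: $[y,\bullet]_B\cap[y',\bullet]_B=\emptyset$ and $[\bullet,y]_B\cap[\bullet,y']_B=\emptyset$; (2) for all $a\leq_A a'$ in $A$ there is a bijection $\varphi_{aa'}:B_a\to B_{a'}$ with $y\leq_B\varphi_{aa'}(y)$ for every $y\in B_a$. For a Ladkani family $\mathcal{B}$, the positive poset $(A\sqcup B)^+_{\mathcal{B}}$ is the set $A\sqcup B$ with the partial order $\leq_+$ that restricts to the given orders on $A$ and on $B$ and whose only relations between elements of $A$ and elements of $B$ are: for $a\in A$, $b\in B$, $a\leq_+ b$ if and only if there is $y\in B_a$ with $y\leq_B b$ (so $b\leq_+a$ never holds). Admissible cut: Let $P$ be a finite poset with a partition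 $P=A\sqcup B$ of its underlying set, with induced orders $\leq_A,\leq_B$. For $a\in A$ let $U_B(a)=\{b\in B: a\leq_P b\}$ and let $M(a)$ be the set of minimal elements of $U_B(a)$ with respect to $\leq_B$. The partition is an admissible cut if: (a) $A$ is an ideal (downward closed) of $P$ and $B$ is a filter (upward closed) of $P$; (b) for every $a\in A$ and all distinct $m,m'\in M(a)$: $[m,\bullet]_B\cap[m',\bullet]_B=\emptyset$ and $[\bullet,m]_B\cap[\bullet,m']_B=\emptyset$; (c) for all $a\leq_A a'$ in $A$ and every $m\in M(a)$ there exists $m'\in M(a')$ with $m\leq_B m'$. *)

theory Defs
  imports Main
begin

text \<open>
  A poset is a carrier set with a relation \<open>r\<close> satisfying \<^const>\<open>partial_order_on\<close>,
  which includes that \<open>r\<close> lives on the carrier. Hence \<^term>\<open>above rB b\<close> and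
  \<^term>\<open>under rB b\<close> are the intervals $[b,\bullet]_B$ and $[\bullet,b]_B$.
  In a disjoint union of posets both carriers are disjoint subsets of one type.
\<close>

definition ladkani_family ::
  "'a set \<Rightarrow> 'a rel \<Rightarrow> 'b set \<Rightarrow> 'b rel \<Rightarrow> ('a \<Rightarrow> 'b set) \<Rightarrow> bool" where
  "ladkani_family A rA B rB F \<longleftrightarrow>
     (\<forall>a\<in>A. F a \<subseteq> B) \<and>
     (\<forall>a\<in>A. \<forall>y\<in>F a. \<forall>y'\<in>F a. y \<noteq> y' \<longrightarrow>
        above rB y \<inter> above rB y' = {} \<and> under rB y \<inter> under rB y' = {}) \<and>
     (\<forall>a\<in>A. \<forall>a'\<in>A. (a, a') \<in> rA \<longrightarrow>
        (\<exists>\<phi>. bij_betw \<phi> (F a) (F a') \<and> (\<forall>y\<in>F a. (y, \<phi> y) \<in> rB)))"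

definition positive_order ::
  "'a set \<Rightarrow> 'a rel \<Rightarrow> 'a set \<Rightarrow> 'a rel \<Rightarrow> ('a \<Rightarrow> 'a set) \<Rightarrow> 'a rel" where
  "positive_order A rA B rB F =
     rA \<union> rB \<union> {(a, b). a \<in> A \<and> b \<in> B \<and> (\<exists>y\<in>F a. (y, b) \<in> rB)}"

definition upper_part :: "'a rel \<Rightarrow> 'a set \<Rightarrow> 'a \<Rightarrow> 'a set" where
  "upper_part r B a = {b \<in> B. (a, b) \<in> r}"

definition minimal_elements :: "'a rel \<Rightarrow> 'a set \<Rightarrow> 'a set" where
  "minimal_elements r S = {m \<in> S. \<forall>x\<in>S. (x, m) \<in> r \<longrightarrow> x = m}"

definition min_upper_part :: "'a rel \<Rightarrow> 'a set \<Rightarrow> 'a \<Rightarrow> 'a set" where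
  "min_upper_part r B a = minimal_elements (Restr r B) (upper_part r B a)"

text \<open>
  The carrier of the ambient poset is \<open>A \<union> B\<close>, with order \<open>r\<close>; it is understood that
  \<open>A\<close> and \<open>B\<close> are disjoint.
\<close>

definition admissible_cut :: "'a rel \<Rightarrow> 'a set \<Rightarrow> 'a set \<Rightarrow> bool" where
  "admissible_cut r A B \<longleftrightarrow>
     (\<forall>a\<in>A. under r a \<subseteq> A) \<and> (\<forall>b\<in>B. above r b \<subseteq> B) \<and>
     (\<forall>a\<in>A. \<forall>m\<in>min_upper_part r B a. \<forall>m'\<in>min_upper_part r B a. m \<noteq> m' \<longrightarrow>
        above (Restr r B) m \<inter> above (Restr r B) m' = {} \<and>
        under (Restr r B) m \<inter> under (Restr r B) m' = {}) \<and>
     (\<forall>a\<in>A. \<forall>a'\<in>A. (a, a') \<in> Restr r A \<longrightarrow>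
        (\<forall>m\<in>min_upper_part r B a. \<exists>m'\<in>min_upper_part r B a'. (m, m') \<in> Restr r B))"

lemma partial_order_on_positive_order:
  assumes A: "partial_order_on A rA" and B: "partial_order_on B rB" and AB: "A \<inter> B = {}"
    and F: "ladkani_family A rA B rB F"
  shows "partial_order_on (A \<union> B) (positive_order A rA B rB F)"
proof -
  let ?R = "positive_order A rA B rB F"
  have sub: "rA \<subseteq> A \<times> A" "rB \<subseteq> B \<times> B" and rfl: "refl_on A rA" "refl_on B rB"
    and tr: "trans rA" "trans rB" and anti: "antisym rA" "antisym rB"
    using A B by (auto simp: partial_order_on_def preorder_on_def)
  have down: "\<exists>y\<in>F a. (y, b) \<in> rB"
    if h: "(a, a') \<in> rA" "y' \<in> F a'" "(y', b) \<in> rB" for a a' y' b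
  proof -
    have "a \<in> A" "a' \<in> A" using h(1) sub(1) by auto
    with F h(1) have "\<exists>\<phi>. bij_betw \<phi> (F a) (F a') \<and> (\<forall>y\<in>F a. (y, \<phi> y) \<in> rB)"
      by (simp add: ladkani_family_def)
    then obtain \<phi> where \<phi>: "bij_betw \<phi> (F a) (F a')" "\<forall>y\<in>F a. (y, \<phi> y) \<in> rB"
      by auto
    have "y' \<in> \<phi> ` F a" using h(2) bij_betw_imp_surj_on[OF \<phi>(1)] by simp
    then obtain y where "y \<in> F a" "\<phi> y = y'"
      by (metis imageE)
    then show ?thesis using \<phi>(2) h(3) tr(2) by (metis transD)
  qed
  have "?R \<subseteq> (A \<union> B) \<times> (A \<union> B)"
    using sub by (auto simp: positive_order_def)
  moreover have "refl_on (A \<union> B) ?R"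
    using rfl by (auto simp: positive_order_def refl_on_def)
  moreover have "trans ?R"
  proof (rule transI)
    fix x y z assume xy: "(x, y) \<in> ?R" and yz: "(y, z) \<in> ?R"
    from xy consider "(x, y) \<in> rA" | "(x, y) \<in> rB" "y \<in> B"
      | w where "x \<in> A" "y \<in> B" "w \<in> F x" "(w, y) \<in> rB"
      using sub(2) by (auto simp: positive_order_def)
    then show "(x, z) \<in> ?R"
    proof cases
      case 1
      then have "x \<in> A" "y \<notin> B" using sub(1) AB by auto
      then have "(y, z) \<in> rA \<or> (z \<in> B \<and> (\<exists>w\<in>F y. (w, z) \<in> rB))"
        using yz sub(2) by (auto simp: positive_order_def)
      then show ?thesis
      proof
        assume "(y, z) \<in> rA"
        then show ?thesis using 1 transD[OF tr(1)] by (auto simp: positive_order_def)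
      next
        assume "z \<in> B \<and> (\<exists>w\<in>F y. (w, z) \<in> rB)"
        then show ?thesis using down[OF 1] \<open>x \<in> A\<close> by (auto simp: positive_order_def)
      qed
    next
      case 2
      then have "(y, z) \<in> rB" using yz sub(1) AB by (auto simp: positive_order_def)
      then show ?thesis using 2 transD[OF tr(2)] by (auto simp: positive_order_def)
    next
      case 3
      then have yz: "(y, z) \<in> rB" using yz sub(1) AB by (auto simp: positive_order_def)
      then have "z \<in> B" "(w, z) \<in> rB" using sub(2) 3(4) transD[OF tr(2)] by auto
      then show ?thesis using 3 by (auto simp: positive_order_def)
    qed
  qed
  moreover have "antisym ?R"
  proof (rule antisymI)
    fix x y assume xy: "(x, y) \<in> ?R" and yx: "(y, x) \<in> ?R"
    have "(x, y) \<in> rA \<and> (y, x) \<in> rA \<or> (x, y) \<in> rB \<and> (y, x) \<in> rB"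
      using xy yx sub AB by (auto simp: positive_order_def)
    then show "x = y" using antisymD[OF anti(1)] antisymD[OF anti(2)] by auto
  qed
  ultimately show ?thesis by (simp add: partial_order_on_def preorder_on_def)
qed

end

theory Submission
  imports Defs
begin

text \<open>
  The relations from \<open>A\<close> to \<open>B\<close> are recorded by the sets \<open>U a\<close> of elements of \<open>B\<close> above
  \<open>a \<in> A\<close>, and the positive order of a family \<open>F\<close> is the one in which \<open>U a\<close> is the
  up-set of \<open>B\<close> generated by \<open>F a\<close>. Now an antichain is the set of minimal elements of the
  up-set that it generates, and the disjointness condition on a Ladkani family makes each \<open>F a\<close>
  an antichain. This forces \<open>F a\<close> to be the set \<open>M a\<close> of minimal elements of \<open>U a\<close>
  (\<open>positive_order_imp_min_upper_part\<close>), which gives uniqueness, and with it the admissible cut: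
  for \<open>F = M\<close> its separation and comparison conditions follow at once from those on a Ladkani
  family, and no element of \<open>B\<close> lies below one of \<open>A\<close> in a positive order.

  Conversely, let the cut be admissible. By finiteness every up-set is generated by its minimal
  elements, so the order is the positive order of \<open>M\<close>
  (\<open>admissible_cut_imp_positive_order\<close>). What an admissible cut does not literally provide are
  the bijections \<open>M a \<rightarrow> M a'\<close> for \<open>a \<le> a'\<close>. They come for free: distinct elements of
  \<open>M a'\<close> have no common lower bound, so each \<open>m \<in> M a\<close> lies below exactly one
  \<open>m' \<in> M a'\<close>; distinct elements of \<open>M a\<close> have no common upper bound, so \<open>m \<mapsto> m'\<close> is
  injective; and \<open>U a' \<subseteq> U a\<close> puts some element of \<open>M a\<close> below each element of \<open>M a'\<close>,
  so the map is surjective (\<open>bij_betw_of_separated\<close>).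
\<close>

lemma partial_order_on_Restr:
  assumes "partial_order_on P r" and "B \<subseteq> P"
  shows "partial_order_on B (Restr r B)"
  using assms
  by (auto simp: partial_order_on_def preorder_on_def refl_on_def antisym_def trans_def)

lemma ex_minimal_elements_below:
  assumes "partial_order_on B r" and "finite S" and "b \<in> S" and "S \<subseteq> B"
  shows "\<exists>m\<in>minimal_elements r S. (m, b) \<in> r"
proof -
  have rfl: "\<And>x. x \<in> B \<Longrightarrow> (x, x) \<in> r" and tr: "trans r" and anti: "antisym r"
    using assms(1) by (auto simp: partial_order_on_def preorder_on_def refl_on_def)
  let ?T = "{x \<in> S. (x, b) \<in> r}"
  let ?lt = "\<lambda>x y. (x, y) \<in> r \<and> x \<noteq> y"
  have "finite ?T" "?T \<noteq> {}" using assms rfl by auto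
  moreover have "asymp_on ?T ?lt" using anti by (auto simp: asymp_on_def antisym_def)
  moreover have "transp_on ?T ?lt"
    using anti tr unfolding transp_on_def antisym_def trans_def by blast
  ultimately obtain m where m: "m \<in> ?T" "\<forall>x\<in>?T. x \<noteq> m \<longrightarrow> \<not> ?lt x m"
    using Finite_Set.bex_min_element[of ?T ?lt] by blast
  have "x = m" if "x \<in> S" "(x, m) \<in> r" for x
  proof -
    have "(x, b) \<in> r" using that(2) m(1) tr by (auto dest: transD)
    then show ?thesis using that m(2) by blast
  qed
  then show ?thesis using m(1) by (auto simp: minimal_elements_def)
qed

lemma minimal_elements_of_generated_up_set:
  assumes "partial_order_on B r" and "Y \<subseteq> B"
    and antichain: "\<And>y y'. y \<in> Y \<Longrightarrow> y' \<in> Y \<Longrightarrow> (y, y') \<in> r \<Longrightarrow> y = y'"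
  shows "minimal_elements r {b. \<exists>y\<in>Y. (y, b) \<in> r} = Y" (is "minimal_elements r ?U = Y")
proof
  have rfl: "\<And>x. x \<in> B \<Longrightarrow> (x, x) \<in> r" and tr: "trans r" and anti: "antisym r"
    using assms(1) by (auto simp: partial_order_on_def preorder_on_def refl_on_def)
  have YU: "Y \<subseteq> ?U" using assms(2) rfl by auto
  show "minimal_elements r ?U \<subseteq> Y"
    using YU by (auto simp: minimal_elements_def)
  show "Y \<subseteq> minimal_elements r ?U"
  proof
    fix y assume y: "y \<in> Y"
    have "x = y" if x: "x \<in> ?U" "(x, y) \<in> r" for x
    proof -
      obtain z where z: "z \<in> Y" "(z, x) \<in> r" using x(1) by auto
      then have "z = y" using antichain y x(2) tr by (blast dest: transD)
      then show ?thesis using z(2) x(2) anti by (auto dest: antisymD)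
    qed
    then show "y \<in> minimal_elements r ?U" using y YU by (auto simp: minimal_elements_def)
  qed
qed

text \<open>
  Comparability is the graph of a bijection between two sets as soon as the separation of
  each set rules out choices: two targets of one source would have a common lower bound, two
  sources of one target a common upper bound.
\<close>

lemma bij_betw_of_separated:
  assumes above: "\<And>m n. m \<in> M \<Longrightarrow> n \<in> M \<Longrightarrow> m \<noteq> n \<Longrightarrow> above r m \<inter> above r n = {}"
    and under: "\<And>m n. m \<in> M' \<Longrightarrow> n \<in> M' \<Longrightarrow> m \<noteq> n \<Longrightarrow> under r m \<inter> under r n = {}"
    and up: "\<And>m. m \<in> M \<Longrightarrow> \<exists>m'\<in>M'. (m, m') \<in> r"
    and down: "\<And>m'. m' \<in> M' \<Longrightarrow> \<exists>m\<in>M. (m, m') \<in> r"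
  shows "\<exists>\<phi>. bij_betw \<phi> M M' \<and> (\<forall>m\<in>M. (m, \<phi> m) \<in> r)"
proof -
  obtain \<phi> where \<phi>: "\<And>m. m \<in> M \<Longrightarrow> \<phi> m \<in> M' \<and> (m, \<phi> m) \<in> r"
    using up by metis
  have "inj_on \<phi> M"
  proof (rule inj_onI)
    fix m n assume mn: "m \<in> M" "n \<in> M" "\<phi> m = \<phi> n"
    then have "\<phi> m \<in> above r m \<inter> above r n"
      using \<phi>[of m] \<phi>[of n] by (simp add: above_def)
    then show "m = n" using above mn by blast
  qed
  moreover have "m' \<in> \<phi> ` M" if m': "m' \<in> M'" for m'
  proof -
    obtain m where m: "m \<in> M" "(m, m') \<in> r" using down[OF m'] by auto
    then have "m \<in> under r m' \<inter> under r (\<phi> m)" using \<phi> by (simp add: under_def)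
    then have "m' = \<phi> m" using under m' \<phi>[OF m(1)] by blast
    then show ?thesis using m(1) by simp
  qed
  ultimately have "bij_betw \<phi> M M'" using \<phi> by (auto simp: bij_betw_def)
  then show ?thesis using \<phi> by blast
qed

text \<open>
  The set \<open>F a\<close> generates the up-set of elements of \<open>B\<close> above \<open>a\<close>, and it is an antichain:
  \<open>y \<le> y'\<close> would make \<open>y'\<close> a common upper bound of \<open>y\<close> and \<open>y'\<close>.
\<close>

lemma positive_order_imp_min_upper_part:
  assumes po: "partial_order_on P r" and BP: "B \<subseteq> P" and AB: "A \<inter> B = {}"
    and F: "ladkani_family A (Restr r A) B (Restr r B) F"
    and r: "r = positive_order A (Restr r A) B (Restr r B) F"
    and a: "a \<in> A"
  shows "F a = min_upper_part r B a"
proof -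
  have poB: "partial_order_on B (Restr r B)" by (rule partial_order_on_Restr[OF po BP])
  have FB: "F a \<subseteq> B" using F a by (simp add: ladkani_family_def)
  have "(a, b) \<in> r \<longleftrightarrow> (\<exists>y\<in>F a. (y, b) \<in> Restr r B)" if "b \<in> B" for b
  proof -
    have "a \<notin> B" "b \<notin> A" using a that AB by auto
    then show ?thesis
      using a that by (subst r) (auto simp: positive_order_def)
  qed
  then have "upper_part r B a = {b. \<exists>y\<in>F a. (y, b) \<in> Restr r B}"
    by (auto simp: upper_part_def)
  moreover have "y = y'" if y: "y \<in> F a" "y' \<in> F a" "(y, y') \<in> Restr r B" for y y'
  proof -
    have "(y', y') \<in> Restr r B" using y(3) poB
      by (auto simp: partial_order_on_def preorder_on_def refl_on_def)
    then have "y' \<in> above (Restr r B) y \<inter> above (Restr r B) y'"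
      using y(3) by (simp add: above_def)
    then show ?thesis using F a y(1,2) unfolding ladkani_family_def by blast
  qed
  ultimately show ?thesis
    using minimal_elements_of_generated_up_set[OF poB FB] by (simp add: min_upper_part_def)
qed

lemma ladkani_family_imp_admissible_cut:
  assumes po: "partial_order_on P r" and BP: "B \<subseteq> P" and AB: "A \<inter> B = {}"
    and F: "ladkani_family A (Restr r A) B (Restr r B) F"
    and r: "r = positive_order A (Restr r A) B (Restr r B) F"
  shows "admissible_cut r A B"
proof -
  have M: "min_upper_part r B a = F a" if "a \<in> A" for a
    using positive_order_imp_min_upper_part[OF po BP AB F r that] by simp
  have cases: "(x, y) \<in> r \<Longrightarrow> x \<in> A \<and> y \<in> A \<or> y \<in> B \<and> (x \<in> A \<or> x \<in> B)" for x y
    by (subst (asm) r) (auto simp: positive_order_def)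
  have "\<exists>m'\<in>F a'. (m, m') \<in> Restr r B"
    if h: "a \<in> A" "a' \<in> A" "(a, a') \<in> Restr r A" "m \<in> F a" for a a' m
  proof -
    obtain \<phi> where "bij_betw \<phi> (F a) (F a')" "\<forall>y\<in>F a. (y, \<phi> y) \<in> Restr r B"
      using F h unfolding ladkani_family_def by meson
    then show ?thesis using h(4) bij_betwE by blast
  qed
  moreover have "\<forall>a\<in>A. under r a \<subseteq> A" and "\<forall>b\<in>B. above r b \<subseteq> B"
    using cases AB by (auto simp: under_def above_def)
  ultimately show ?thesis
    using F by (simp add: admissible_cut_def ladkani_family_def M)
qed

lemma ex_min_upper_part_below:
  assumes po: "partial_order_on P r" and BP: "B \<subseteq> P" and fin: "finite B"
    and b: "b \<in> B" "(a, b) \<in> r"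
  shows "\<exists>m\<in>min_upper_part r B a. (m, b) \<in> Restr r B"
  unfolding min_upper_part_def
  using b fin
  by (intro ex_minimal_elements_below[OF partial_order_on_Restr[OF po BP]])
     (auto simp: upper_part_def)

lemma admissible_cut_imp_positive_order:
  assumes po: "partial_order_on (A \<union> B) r" and fin: "finite B" and AB: "A \<inter> B = {}"
    and cut: "admissible_cut r A B"
  shows "r = positive_order A (Restr r A) B (Restr r B) (min_upper_part r B)"
    (is "r = ?R")
proof
  have sub: "r \<subseteq> (A \<union> B) \<times> (A \<union> B)" and tr: "trans r"
    using po by (auto simp: partial_order_on_def preorder_on_def)
  show "r \<subseteq> ?R"
  proof (rule subrelI)
    fix x y assume xy: "(x, y) \<in> r"
    have "y \<in> B" if "x \<in> B"
      using cut xy that by (auto simp: admissible_cut_def above_def)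
    then consider "x \<in> A" "y \<in> A" | "x \<in> B" "y \<in> B" | "x \<in> A" "y \<in> B"
      using sub xy by blast
    then show "(x, y) \<in> ?R"
    proof cases
      case 3
      then show ?thesis
        using ex_min_upper_part_below[OF po _ fin _ xy] by (auto simp: positive_order_def)
    qed (use xy in \<open>auto simp: positive_order_def\<close>)
  qed
  show "?R \<subseteq> r"
    using tr by (auto simp: positive_order_def min_upper_part_def minimal_elements_def
        upper_part_def dest: transD)
qed

lemma admissible_cut_imp_ladkani_family:
  assumes po: "partial_order_on P r" and BP: "B \<subseteq> P" and fin: "finite B"
    and cut: "admissible_cut r A B"
  shows "ladkani_family A (Restr r A) B (Restr r B) (min_upper_part r B)"
proof -
  let ?M = "min_upper_part r B"
  have tr: "trans r" using po by (auto simp: partial_order_on_def preorder_on_def)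
  have sep: "above (Restr r B) m \<inter> above (Restr r B) n = {} \<and>
      under (Restr r B) m \<inter> under (Restr r B) n = {}"
    if "a \<in> A" "m \<in> ?M a" "n \<in> ?M a" "m \<noteq> n" for a m n
    using cut that by (simp add: admissible_cut_def)
  have M: "?M a \<subseteq> upper_part r B a" for a
    by (auto simp: min_upper_part_def minimal_elements_def)
  have "\<exists>\<phi>. bij_betw \<phi> (?M a) (?M a') \<and> (\<forall>m\<in>?M a. (m, \<phi> m) \<in> Restr r B)"
    if h: "a \<in> A" "a' \<in> A" "(a, a') \<in> Restr r A" for a a'
  proof (rule bij_betw_of_separated)
    show "\<exists>m'\<in>?M a'. (m, m') \<in> Restr r B" if "m \<in> ?M a" for m
      using cut h that unfolding admissible_cut_def by blast
    show "\<exists>m\<in>?M a. (m, m') \<in> Restr r B" if "m' \<in> ?M a'" for m'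
    proof (rule ex_min_upper_part_below[OF po BP fin])
      show "m' \<in> B" "(a, m') \<in> r"
        using M that h(3) tr by (auto simp: upper_part_def dest: transD)
    qed
  qed (use sep h in auto)
  moreover have "\<forall>a\<in>A. ?M a \<subseteq> B" using M by (auto simp: upper_part_def)
  ultimately show ?thesis using sep unfolding ladkani_family_def by blast
qed

theorem theorem3p2:
  fixes P A B :: "'a set" and r :: "'a rel"
  assumes "finite P" and "partial_order_on P r"
    and "P = A \<union> B" and "A \<inter> B = {}"
  shows "((\<exists>F. ladkani_family A (Restr r A) B (Restr r B) F \<and>
               r = positive_order A (Restr r A) B (Restr r B) F)
            \<longleftrightarrow> admissible_cut r A B) \<and>
         (\<forall>F. ladkani_family A (Restr r A) B (Restr r B) F \<and>
              r = positive_order A (Restr r A) B (Restr r B) F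
            \<longrightarrow> (\<forall>a\<in>A. F a = min_upper_part r B a))"
proof -
  have BP: "B \<subseteq> P" and fin: "finite B" and po: "partial_order_on (A \<union> B) r"
    using assms by auto
  show ?thesis
    using positive_order_imp_min_upper_part[OF assms(2) BP assms(4)]
      ladkani_family_imp_admissible_cut[OF assms(2) BP assms(4)]
      admissible_cut_imp_ladkani_family[OF assms(2) BP fin]
      admissible_cut_imp_positive_order[OF po fin assms(4)]
    by blast
qed

end
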